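(* Let $X\neq\{0\}$ be a Banach space and let $E$ be an invariant sequence space over $X$. Then: (a) For every subset $\Gamma\subseteq(0,\infty]$, the set $E-\bigcup_{q\in\Gamma}\ell_{q}(X)$ is either empty or spaceable in $E$. (b) The set $E-c_{0}(X)$ is either empty or spaceable in $E$.
   Context: All Banach and quasi-Banach spaces are over a fixed scalar field $\mathbb{K}$, which is either $\mathbb{R}$ or $\mathbb{C}$. A subset $A$ of a Banach or quasi-Banach space $E$ is spaceable (in $E$) if $A\cup\{0\}$ contains a closed infinite-dimensional linear subspace of $E$. Let $X\neq\{0\}$ be a Banach space. For $x\in X^{\mathbb{N}}$, its zerofree version $x^{0}$ is defined as follows: if $x$ has only finitely many non-zero coordinates, then $x^{0}=0$; otherwise $x^{0}=(x_{j})_{j=1}^{\infty}$, where $x_{j}$ is the $j$-th non-zero coordinate of $x$. An invariant sequence space over $X$ is an infinite-dimensional Banach or quasi-Banach space $E$ of $X$-valued sequences (a linear subspace of $X^{\mathbb{N}}$ with a complete norm or quasi-norm $\|\cdot\|_E$) such that: (b1) for every $x\in X^{\mathbb{N}}$ with $x^{0}\neq 0$, one has $x\in E$ if and only if $x^{0}\in E$, and in this case $\|x\|_E\leq K\|x^{0}\|_E$ for some constant $K$ depending only on $E$; (b2) $\|x_{j}\|_{X}\leq\|x\|_{E}$ for every $x=(x_{j})_{j=1}^{\infty}\in E$ and every $j\in\mathbb{N}$. For $0<q<\infty$, $\ell_q(X)$ is the space of sequences $(x_j)_{j=1}^\infty\in X^{\mathbb N}$ with $\sum_j\|x_j\|^q<\infty$;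 $\ell_\infty(X)$ is the space of bounded $X$-valued sequences; $c_0(X)$ is the space of $X$-valued sequences converging to $0$ in norm. The differences are set differences of subsets of $X^{\mathbb{N}}$ (no inclusion is assumed). *)

theory Defs
  imports
    "HOL-Analysis.Analysis"
    "HOL-Library.Function_Algebras"
    "HOL-Library.Infinite_Set"
begin

text \<open>The scalar field: up to an isometric isomorphism, the members of this class are exactly the
  real and the complex numbers with the usual absolute value.\<close>

class real_or_complex = real_normed_field +
  assumes real_or_complex:
    "(\<forall>z. \<exists>a. z = a *\<^sub>R 1) \<or>
     (\<exists>j. j * j = - 1 \<and> (\<forall>z. \<exists>a b. z = a *\<^sub>R 1 + b *\<^sub>R j \<and> norm z = sqrt (a\<^sup>2 + b\<^sup>2)))"

instance real :: real_or_complex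
  by standard auto

instance complex :: real_or_complex
proof
  have "\<exists>a b. z = a *\<^sub>R 1 + b *\<^sub>R \<i> \<and> norm z = sqrt (a\<^sup>2 + b\<^sup>2)" for z :: complex
    by (rule exI[of _ "Re z"], rule exI[of _ "Im z"]) (simp add: complex_eq_iff cmod_def)
  then show "(\<forall>z::complex. \<exists>a. z = a *\<^sub>R 1) \<or>
     (\<exists>j::complex. j * j = - 1 \<and>
        (\<forall>z. \<exists>a b. z = a *\<^sub>R 1 + b *\<^sub>R j \<and> norm z = sqrt (a\<^sup>2 + b\<^sup>2)))"
    by (intro disjI2 exI[of _ \<i>]) auto
qed

text \<open>The type class \<^class>\<open>banach\<close> supplies the addition, the complete norm and the real scalar
  multiplication.  The compatibility axiom \<open>scale_of_real\<close> is no restriction: it follows from the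
  other axioms, as both sides are additive and continuous in \<open>r\<close> and agree at 1.\<close>

locale banach_space_over = vector_space smul
  for smul :: "'k::real_or_complex \<Rightarrow> 'a::banach \<Rightarrow> 'a" +
  assumes norm_scale: "norm (smul c x) = norm c * norm x"
    and scale_of_real: "smul (of_real r) x = r *\<^sub>R x"

context vector_space
begin

definition infinite_dimensional :: "'b set \<Rightarrow> bool" where
  "infinite_dimensional V \<longleftrightarrow> \<not> (\<exists>B. finite B \<and> B \<subseteq> V \<and> V \<subseteq> span B)"

end

text \<open>The topology of a quasi-norm \<open>N\<close> on \<open>E\<close>.  The balls \<open>{y \<in> E. N (y - x) < e}\<close> form a base of
  neighbourhoods of \<open>x\<close>, but they need not be open themselves.\<close>

definition quasi_norm_topology :: "'v::ab_group_add set \<Rightarrow> ('v \<Rightarrow> real) \<Rightarrow> 'v topology" where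
  "quasi_norm_topology E N =
     topology (\<lambda>U. U \<subseteq> E \<and> (\<forall>x\<in>U. \<exists>e>0. \<forall>y\<in>E. N (y - x) < e \<longrightarrow> y \<in> U))"

lemma openin_quasi_norm_topology:
  "openin (quasi_norm_topology E N) U \<longleftrightarrow>
     U \<subseteq> E \<and> (\<forall>x\<in>U. \<exists>e>0. \<forall>y\<in>E. N (y - x) < e \<longrightarrow> y \<in> U)"
proof -
  let ?P = "\<lambda>U. U \<subseteq> E \<and> (\<forall>x\<in>U. \<exists>e>0. \<forall>y\<in>E. N (y - x) < e \<longrightarrow> y \<in> U)"
  have "?P (S \<inter> T)" if S: "?P S" and T: "?P T" for S T
  proof (intro conjI ballI)
    show "S \<inter> T \<subseteq> E" using S by blast
    fix x assume x: "x \<in> S \<inter> T"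
    obtain d where d: "d > 0" "\<forall>y\<in>E. N (y - x) < d \<longrightarrow> y \<in> S" using S x by blast
    obtain e where e: "e > 0" "\<forall>y\<in>E. N (y - x) < e \<longrightarrow> y \<in> T" using T x by blast
    show "\<exists>e>0. \<forall>y\<in>E. N (y - x) < e \<longrightarrow> y \<in> S \<inter> T"
      using d e by (intro exI[of _ "min d e"]) auto
  qed
  moreover have "?P (\<Union>\<K>)" if "\<forall>K\<in>\<K>. ?P K" for \<K>
    using that by (intro conjI ballI) (blast, meson UnionE UnionI)
  ultimately have "istopology ?P"
    unfolding istopology_def by blast
  then show ?thesis
    by (simp add: quasi_norm_topology_def topology_inverse')
qed

lemma topspace_quasi_norm_topology [simp]: "topspace (quasi_norm_topology E N) = E"
proof -
  have "openin (quasi_norm_topology E N) E"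
    unfolding openin_quasi_norm_topology by (auto intro: exI[of _ 1])
  then show ?thesis
    by (metis openin_quasi_norm_topology openin_subset openin_topspace subset_antisym)
qed

text \<open>Banach spaces are the case \<open>C = 1\<close> of the quasi-triangle inequality.\<close>

locale quasi_banach_space = vector_space smul
  for smul :: "'k::real_or_complex \<Rightarrow> 'v::ab_group_add \<Rightarrow> 'v" +
  fixes E :: "'v set" and N :: "'v \<Rightarrow> real"
  assumes subspace_E: "subspace E"
    and N_nonneg: "x \<in> E \<Longrightarrow> 0 \<le> N x"
    and N_eq_0_iff: "x \<in> E \<Longrightarrow> N x = 0 \<longleftrightarrow> x = 0"
    and N_scale: "x \<in> E \<Longrightarrow> N (smul c x) = norm c * N x"
    and N_quasi_triangle: "\<exists>C\<ge>1. \<forall>x\<in>E. \<forall>y\<in>E. N (x + y) \<le> C * (N x + N y)"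
    and N_complete:
      "\<lbrakk>\<And>n. u n \<in> E; \<And>e. e > 0 \<Longrightarrow> \<exists>M. \<forall>m\<ge>M. \<forall>n\<ge>M. N (u m - u n) < e\<rbrakk> \<Longrightarrow>
         \<exists>x\<in>E. (\<lambda>n. N (u n - x)) \<longlonglongrightarrow> 0"
begin

definition spaceable :: "'v set \<Rightarrow> bool" where
  "spaceable A \<longleftrightarrow>
     (\<exists>V. V \<subseteq> A \<union> {0} \<and> subspace V \<and> infinite_dimensional V \<and>
          closedin (quasi_norm_topology E N) V)"

end

text \<open>Sequences are indexed from 0.\<close>

definition seq_scale :: "('k \<Rightarrow> 'a \<Rightarrow> 'a) \<Rightarrow> 'k \<Rightarrow> (nat \<Rightarrow> 'a) \<Rightarrow> nat \<Rightarrow> 'a" where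
  "seq_scale smul c x = (\<lambda>j. smul c (x j))"

definition zerofree :: "(nat \<Rightarrow> 'a::zero) \<Rightarrow> nat \<Rightarrow> 'a" where
  "zerofree x =
     (if finite {i. x i \<noteq> 0} then 0 else (\<lambda>j. x (enumerate {i. x i \<noteq> 0} j)))"

locale invariant_sequence_space =
  X: banach_space_over smul + quasi_banach_space "seq_scale smul" E N
  for smul :: "'k::real_or_complex \<Rightarrow> 'a::banach \<Rightarrow> 'a"
    and E :: "(nat \<Rightarrow> 'a) set" and N :: "(nat \<Rightarrow> 'a) \<Rightarrow> real" +
  assumes infinite_dimensional_E: "infinite_dimensional E"
    and mem_iff_zerofree_mem: "zerofree x \<noteq> 0 \<Longrightarrow> x \<in> E \<longleftrightarrow> zerofree x \<in> E"
    and N_le_N_zerofree: "\<exists>K. \<forall>x\<in>E. zerofree x \<noteq> 0 \<longrightarrow> N x \<le> K * N (zerofree x)"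
    and norm_le_N: "x \<in> E \<Longrightarrow> norm (x j) \<le> N x"

definition ell :: "ereal \<Rightarrow> (nat \<Rightarrow> 'a::real_normed_vector) set" where
  "ell q =
     (if q = \<infinity> then {x. bounded (range x)}
      else {x. summable (\<lambda>j. norm (x j) powr real_of_ereal q)})"

definition c_zero :: "(nat \<Rightarrow> 'a::real_normed_vector) set" where
  "c_zero = {x. x \<longlonglongrightarrow> 0}"

end

theory Submission
  imports Defs
begin

text \<open>
  Let \<open>A\<close> be the set that is removed from \<open>E\<close>: a non-empty union of spaces \<open>\<ell>\<^sub>q(X)\<close>, or \<open>c\<^sub>0(X)\<close>.
  (For the empty union, \<open>E\<close> itself is the required subspace.)  For the argument
  only its insensitivity to zeros, subsequences and scalars matters, which is recorded in
  \<open>zero_insensitive\<close>.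

  Take \<open>x \<in> E - A\<close>.  Deleting its zeros gives a sequence \<open>y = (y\<^sub>j)\<close> without zero coordinates that
  still lies in \<open>E - A\<close>.  Arrange the index set as an infinite matrix, by the pairing bijection, and
  let \<open>V\<close> consist of those members of \<open>E\<close> each of whose rows is a scalar multiple of \<open>y\<close>
  (\<open>rowwise_multiples\<close>).  This \<open>V\<close> is the required subspace:

  \<^item> A non-zero member of \<open>V\<close> has a row \<open>c y\<close> with \<open>c \<noteq> 0\<close>.  If it were in \<open>A\<close>, so would be its
    subsequence \<open>c y\<close>, hence \<open>y\<close>.
  \<^item> \<open>V\<close> is infinite-dimensional.  Putting \<open>y\<close> in one row and zeros elsewhere gives a sequence with
    zerofree version \<open>y\<close>, which is therefore in \<open>E\<close> by invariance; these sequences are linearly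
    independent.
  \<^item> \<open>V\<close> is closed, because \<open>\<parallel>x\<^sub>j\<parallel> \<le> \<parallel>x\<parallel>\<^sub>E\<close> makes convergence in \<open>E\<close> imply coordinatewise
    convergence, and the scalar multiples of \<open>y\<close> are closed under coordinatewise limits, by
    compactness of bounded closed sets of scalars (\<open>scalar_multiple_if_approximable\<close>).

  Describing \<open>V\<close> by this coordinatewise condition, instead of as the closure of the span of the
  one-row sequences, avoids all infinite sums in \<open>E\<close>.
\<close>

section \<open>Sequence sets that ignore zeros, subsequences and scalars\<close>

text \<open>Abstracts what \<open>\<ell>\<^sub>q(X)\<close>, \<open>c\<^sub>0(X)\<close> and unions of such spaces have in common.  In the third
  clause \<open>x\<close> arises from \<open>x \<circ> g\<close> by inserting zeros outside the positions that \<open>g\<close> lists.\<close>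

definition zero_insensitive ::
    "('k::field \<Rightarrow> 'a::zero \<Rightarrow> 'a) \<Rightarrow> (nat \<Rightarrow> 'a) set \<Rightarrow> bool" where
  "zero_insensitive smul A \<longleftrightarrow>
     (\<forall>x. finite {i. x i \<noteq> 0} \<longrightarrow> x \<in> A) \<and>
     (\<forall>x\<in>A. \<forall>g::nat \<Rightarrow> nat. strict_mono g \<longrightarrow> x \<circ> g \<in> A) \<and>
     (\<forall>x. \<forall>g::nat \<Rightarrow> nat. strict_mono g \<longrightarrow> (\<forall>n. n \<notin> range g \<longrightarrow> x n = 0) \<longrightarrow> x \<circ> g \<in> A \<longrightarrow> x \<in> A) \<and>
     (\<forall>x\<in>A. \<forall>c. seq_scale smul c x \<in> A)"

lemma zero_insensitiveI:
  assumes "\<And>x. finite {i. x i \<noteq> 0} \<Longrightarrow> x \<in> A"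
    and "\<And>x g. x \<in> A \<Longrightarrow> strict_mono g \<Longrightarrow> x \<circ> g \<in> A"
    and "\<And>x g. strict_mono g \<Longrightarrow> \<forall>n. n \<notin> range g \<longrightarrow> x n = 0 \<Longrightarrow> x \<circ> g \<in> A \<Longrightarrow> x \<in> A"
    and "\<And>x c. x \<in> A \<Longrightarrow> seq_scale smul c x \<in> A"
  shows "zero_insensitive smul A"
  unfolding zero_insensitive_def using assms by (intro conjI allI ballI impI) assumption+

lemma zero_insensitiveD:
  assumes "zero_insensitive smul A"
  shows "finite {i. x i \<noteq> 0} \<Longrightarrow> x \<in> A"
    and "x \<in> A \<Longrightarrow> strict_mono g \<Longrightarrow> x \<circ> g \<in> A"
    and "strict_mono g \<Longrightarrow> \<forall>n. n \<notin> range g \<longrightarrow> x n = 0 \<Longrightarrow> x \<circ> g \<in> A \<Longrightarrow> x \<in> A"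
    and "x \<in> A \<Longrightarrow> seq_scale smul c x \<in> A"
  using assms unfolding zero_insensitive_def by simp_all

lemma zero_insensitive_Union:
  assumes "\<A> \<noteq> {}" and ideal: "\<And>A. A \<in> \<A> \<Longrightarrow> zero_insensitive smul A"
  shows "zero_insensitive smul (\<Union>\<A>)"
proof (rule zero_insensitiveI)
  show "x \<in> \<Union>\<A>" if "finite {i. x i \<noteq> 0}" for x
    using assms(1) zero_insensitiveD(1)[OF ideal that] by auto
  show "x \<circ> g \<in> \<Union>\<A>" if "x \<in> \<Union>\<A>" "strict_mono g" for x g
    using that zero_insensitiveD(2)[OF ideal] by (meson UnionE UnionI)
  show "x \<in> \<Union>\<A>" if "strict_mono g" "\<forall>n. n \<notin> range g \<longrightarrow> x n = 0" "x \<circ> g \<in> \<Union>\<A>" for x g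
    using that(3) zero_insensitiveD(3)[OF ideal that(1,2)] by (meson UnionE UnionI)
  show "seq_scale smul c x \<in> \<Union>\<A>" if "x \<in> \<Union>\<A>" for x c
    using that zero_insensitiveD(4)[OF ideal] by (meson UnionE UnionI)
qed

lemma zero_insensitive_c_zero:
  assumes "banach_space_over smul"
  shows "zero_insensitive smul c_zero"
proof -
  interpret banach_space_over smul by fact
  have "x \<longlonglongrightarrow> 0" if "finite {i. x i \<noteq> 0}" for x :: "nat \<Rightarrow> 'b"
    using that
    by (intro tendsto_eventually) (simp add: eventually_cofinite flip: cofinite_eq_sequentially)
  moreover have "(x \<circ> g) \<longlonglongrightarrow> 0" if "x \<longlonglongrightarrow> 0" "strict_mono g" for x :: "nat \<Rightarrow> 'b" and g
    using that by (rule LIMSEQ_subseq_LIMSEQ)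
  moreover have "x \<longlonglongrightarrow> 0"
    if g: "strict_mono g" and 0: "\<forall>n. n \<notin> range g \<longrightarrow> x n = 0" and lim: "(x \<circ> g) \<longlonglongrightarrow> 0"
    for x :: "nat \<Rightarrow> 'b" and g :: "nat \<Rightarrow> nat"
  proof (rule LIMSEQ_I)
    fix e :: real assume "0 < e"
    then obtain M where M: "\<And>j. j \<ge> M \<Longrightarrow> norm (x (g j)) < e"
      using LIMSEQ_D[OF lim] by auto
    have "norm (x n) < e" if "n \<ge> g M" for n
    proof (cases "n \<in> range g")
      case True
      then show ?thesis using M that g by (auto simp: strict_mono_less_eq)
    qed (use 0 \<open>0 < e\<close> in auto)
    then show "\<exists>no. \<forall>n\<ge>no. norm (x n - 0) < e" by auto
  qed
  moreover have "seq_scale smul c x \<longlonglongrightarrow> 0" if "x \<longlonglongrightarrow> 0" for c and x :: "nat \<Rightarrow> 'b"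
    using tendsto_mult_right_zero[OF tendsto_norm_zero[OF that], of "norm c"]
    by (intro tendsto_norm_zero_cancel[where f = "seq_scale smul c x"])
      (simp add: seq_scale_def norm_scale)
  ultimately show ?thesis
    unfolding c_zero_def by (intro zero_insensitiveI; simp only: mem_Collect_eq)
qed

lemma zero_insensitive_ell:
  assumes "banach_space_over smul"
  shows "zero_insensitive smul (ell q)"
proof -
  interpret banach_space_over smul by fact
  show ?thesis
  proof (cases "q = \<infinity>")
    case True
    have *: "bounded (range x)"
      if "\<forall>n. n \<notin> S \<longrightarrow> x n = 0" "bounded (x ` S)" for x :: "nat \<Rightarrow> 'b" and S
      using that by (intro bounded_subset[of "insert 0 (x ` S)" "range x"]) auto
    have "bounded (range x)" if "finite {i. x i \<noteq> 0}" for x :: "nat \<Rightarrow> 'b"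
      using that by (intro *[of "{i. x i \<noteq> 0}"]) (auto intro: finite_imp_bounded)
    moreover have "bounded (range (x \<circ> g))" if "bounded (range x)"
      for x :: "nat \<Rightarrow> 'b" and g :: "nat \<Rightarrow> nat"
      using that by (rule bounded_subset) auto
    moreover have "bounded (range x)"
      if "\<forall>n. n \<notin> range g \<longrightarrow> x n = 0" "bounded (range (x \<circ> g))"
      for x :: "nat \<Rightarrow> 'b" and g :: "nat \<Rightarrow> nat"
      using that by (intro *[of "range g"]) (auto simp: image_comp)
    moreover have "bounded (range (seq_scale smul c x))" if x: "bounded (range x)"
      for c and x :: "nat \<Rightarrow> 'b"
    proof -
      obtain b where "\<And>j. norm (x j) \<le> b" using x by (auto simp: bounded_iff)
      then show ?thesis
        by (auto simp: bounded_iff seq_scale_def norm_scale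
            intro!: exI[of _ "norm c * b"] mult_left_mono)
    qed
    ultimately show ?thesis
      using True by (intro zero_insensitiveI; simp only: ell_def if_True mem_Collect_eq)
  next
    case False
    define p where "p = real_of_ereal q"
    have "summable (\<lambda>j. norm (x j) powr p)" if "finite {i. x i \<noteq> 0}" for x :: "nat \<Rightarrow> 'b"
      using that by (intro summable_finite[of "{i. x i \<noteq> 0}"]) auto
    moreover have "summable (\<lambda>j. norm ((x \<circ> g) j) powr p)"
      if "summable (\<lambda>j. norm (x j) powr p)" "strict_mono g" for x :: "nat \<Rightarrow> 'b" and g
      using summable_reindex[OF that(1), of g] that(2) by (simp add: strict_mono_imp_inj_on o_def)
    moreover have "summable (\<lambda>j. norm (x j) powr p)"
      if "strict_mono g" "\<forall>n. n \<notin> range g \<longrightarrow> x n = 0" "summable (\<lambda>j. norm ((x \<circ> g) j) powr p)"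
      for x :: "nat \<Rightarrow> 'b" and g
      using that summable_mono_reindex[OF that(1), of "\<lambda>j. norm (x j) powr p"] by simp
    moreover have "summable (\<lambda>j. norm (seq_scale smul c x j) powr p)"
      if "summable (\<lambda>j. norm (x j) powr p)" for c and x :: "nat \<Rightarrow> 'b"
      using summable_mult[OF that, of "norm c powr p"]
      by (simp add: seq_scale_def norm_scale powr_mult)
    ultimately show ?thesis
      using False
      by (intro zero_insensitiveI; simp only: ell_def if_False mem_Collect_eq flip: p_def)
  qed
qed

section \<open>Compactness of scalar balls\<close>

text \<open>The representation of the scalars by one or two real coordinates puts a ball inside the
  continuous image of a compact square.\<close>

lemma compact_scalar_cball: "compact (cball (0::'k::real_or_complex) M)"
proof -
  have "\<exists>K. compact K \<and> cball (0::'k) M \<subseteq> K"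
    using real_or_complex
  proof
    assume real: "\<forall>z::'k. \<exists>a. z = a *\<^sub>R 1"
    have "compact ((\<lambda>a. a *\<^sub>R (1::'k)) ` {-M..M})"
      by (intro compact_continuous_image continuous_intros compact_Icc)
    moreover have "cball (0::'k) M \<subseteq> (\<lambda>a. a *\<^sub>R (1::'k)) ` {-M..M}"
    proof
      fix z :: 'k assume z: "z \<in> cball 0 M"
      obtain a where "z = a *\<^sub>R 1" using real by blast
      with z show "z \<in> (\<lambda>a. a *\<^sub>R (1::'k)) ` {-M..M}"
        by (intro image_eqI[of _ _ a]) auto
    qed
    ultimately show ?thesis by blast
  next
    assume "\<exists>j::'k. j * j = - 1 \<and>
      (\<forall>z. \<exists>a b. z = a *\<^sub>R 1 + b *\<^sub>R j \<and> norm z = sqrt (a\<^sup>2 + b\<^sup>2))"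
    then obtain j :: 'k where
      j: "\<And>z. \<exists>a b. z = a *\<^sub>R 1 + b *\<^sub>R j \<and> norm z = sqrt (a\<^sup>2 + b\<^sup>2)" by blast
    let ?f = "\<lambda>p::real \<times> real. fst p *\<^sub>R 1 + snd p *\<^sub>R j"
    have "compact (?f ` ({-M..M} \<times> {-M..M}))"
      by (intro compact_continuous_image continuous_intros compact_Times compact_Icc)
    moreover have "cball (0::'k) M \<subseteq> ?f ` ({-M..M} \<times> {-M..M})"
    proof
      fix z :: 'k assume z: "z \<in> cball 0 M"
      obtain a b where ab: "z = a *\<^sub>R 1 + b *\<^sub>R j" "norm z = sqrt (a\<^sup>2 + b\<^sup>2)" using j by blast
      have "\<bar>a\<bar> \<le> norm z" "\<bar>b\<bar> \<le> norm z"
        unfolding ab(2) by (simp_all add: real_le_rsqrt)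
      then have "\<bar>a\<bar> \<le> M" "\<bar>b\<bar> \<le> M" using z by auto
      then have "(a, b) \<in> {-M..M} \<times> {-M..M}" by auto
      then show "z \<in> ?f ` ({-M..M} \<times> {-M..M})" using ab(1)
        by (intro image_eqI[of _ _ "(a, b)"]) simp_all
    qed
    ultimately show ?thesis by blast
  qed
  then show ?thesis
    by (metis closed_cball compact_Int_closed inf.absorb2)
qed

text \<open>Uniform approximation is what convergence in an invariant sequence space yields.  Since \<open>y\<close>
  is somewhere non-zero, the approximating scalars are bounded, so they accumulate at some scalar.\<close>

lemma (in banach_space_over) scalar_multiple_if_approximable:
  assumes y: "y k \<noteq> 0"
    and approx: "\<And>e. e > 0 \<Longrightarrow> \<exists>c. \<forall>j. norm (smul c (y j) - x j) < e"
  shows "\<exists>c. \<forall>j. x j = smul c (y j)"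
proof -
  have "\<exists>c. \<forall>j. norm (smul c (y j) - x j) < inverse (real (Suc n))" for n
    by (rule approx) simp
  then obtain c where c: "\<And>n j. norm (smul (c n) (y j) - x j) < inverse (real (Suc n))"
    by metis
  define M where "M = (norm (x k) + 1) / norm (y k)"
  have "norm (c n) \<le> M" for n
  proof -
    have "norm (smul (c n) (y k)) \<le> norm (x k) + norm (smul (c n) (y k) - x k)"
      by (rule norm_triangle_sub)
    also have "\<dots> \<le> norm (x k) + 1"
      using c[of n k] inverse_le_1_iff[of "real (Suc n)"] by linarith
    finally show ?thesis using y by (simp add: M_def norm_scale field_simps)
  qed
  then have "\<And>n. c n \<in> cball 0 M" by simp
  then obtain l r where r: "strict_mono r" "(c \<circ> r) \<longlonglongrightarrow> l"
    using compact_scalar_cball[of M] unfolding compact_def by blast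
  have "x j = smul l (y j)" for j
  proof (rule LIMSEQ_unique)
    have "(\<lambda>n. smul (c n) (y j) - x j) \<longlonglongrightarrow> 0"
      by (rule Lim_null_comparison[OF _ LIMSEQ_inverse_real_of_nat])
        (use c less_imp_le in \<open>auto intro!: eventuallyI\<close>)
    then have "(\<lambda>n. smul (c n) (y j)) \<longlonglongrightarrow> x j" by (rule LIM_zero_cancel)
    from LIMSEQ_subseq_LIMSEQ[OF this r(1)]
    show "(\<lambda>n. smul (c (r n)) (y j)) \<longlonglongrightarrow> x j" by (simp add: o_def)
    have "(\<lambda>n. norm (c (r n) - l) * norm (y j)) \<longlonglongrightarrow> 0"
      using r(2) by (intro tendsto_mult_left_zero tendsto_norm_zero) (simp add: LIM_zero o_def)
    then have "(\<lambda>n. norm (smul (c (r n)) (y j) - smul l (y j))) \<longlonglongrightarrow> 0"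
      by (simp add: norm_scale flip: scale_left_diff_distrib)
    then show "(\<lambda>n. smul (c (r n)) (y j)) \<longlonglongrightarrow> smul l (y j)"
      by (rule LIM_zero_cancel[OF tendsto_norm_zero_cancel])
  qed
  then show ?thesis by blast
qed

section \<open>Zerofree versions\<close>

lemma enumerate_range_strict_mono:
  fixes f :: "nat \<Rightarrow> nat"
  assumes f: "strict_mono f"
  shows "enumerate (range f) = f"
proof
  have inf: "infinite (range f)"
    using f by (simp add: finite_image_iff strict_mono_imp_inj_on)
  show "enumerate (range f) n = f n" for n
  proof (induction n)
    case 0
    show ?case unfolding enumerate_0
      by (rule Least_equality) (use f in \<open>auto simp: strict_mono_less_eq\<close>)
  next
    case (Suc n)
    show ?case unfolding enumerate_Suc''[OF inf] Suc
      by (rule Least_equality) (use f in \<open>auto simp: strict_mono_less_eq strict_mono_less\<close>)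
  qed
qed

lemma zerofree_eq_comp:
  assumes "strict_mono g" and "{i. x i \<noteq> 0} = range g"
  shows "zerofree x = x \<circ> g"
  using assms
  by (auto simp: zerofree_def enumerate_range_strict_mono finite_image_iff strict_mono_imp_inj_on)

section \<open>Sequences with every row a multiple of a fixed one\<close>

lemma strict_mono_prod_encode: "strict_mono (\<lambda>j. prod_encode (i, j))"
  by (simp add: strict_mono_Suc_iff prod_encode_def)

definition one_row :: "(nat \<Rightarrow> 'a::zero) \<Rightarrow> nat \<Rightarrow> nat \<Rightarrow> 'a" where
  "one_row y i n = (if fst (prod_decode n) = i then y (snd (prod_decode n)) else 0)"

lemma one_row_prod_encode [simp]: "one_row y i (prod_encode (k, j)) = (if k = i then y j else 0)"
  by (simp add: one_row_def)

lemma zerofree_one_row: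
  assumes "\<And>j. y j \<noteq> 0"
  shows "zerofree (one_row y i) = y"
proof -
  have "{n. one_row y i n \<noteq> 0} = range (\<lambda>j. prod_encode (i, j))"
  proof (intro equalityI subsetI)
    fix n assume "n \<in> {n. one_row y i n \<noteq> 0}"
    then have "n = prod_encode (i, snd (prod_decode n))"
      by (auto simp: one_row_def split: if_splits)
    then show "n \<in> range (\<lambda>j. prod_encode (i, j))" by blast
  qed (use assms in auto)
  from zerofree_eq_comp[OF strict_mono_prod_encode this] show ?thesis
    by auto
qed

definition rowwise_multiples ::
    "('k \<Rightarrow> 'a \<Rightarrow> 'a) \<Rightarrow> (nat \<Rightarrow> 'a) \<Rightarrow> (nat \<Rightarrow> 'a) set" where
  "rowwise_multiples smul y = {z. \<forall>i. \<exists>c. \<forall>j. z (prod_encode (i, j)) = smul c (y j)}"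

context invariant_sequence_space
begin

lemma subspace_rowwise_multiples: "subspace (rowwise_multiples smul y)"
proof (rule subspaceI)
  have "\<exists>c. \<forall>j. (0::nat \<Rightarrow> 'a) (prod_encode (i, j)) = smul c (y j)" for i
    by (rule exI[of _ 0]) simp
  then show "0 \<in> rowwise_multiples smul y" by (simp add: rowwise_multiples_def)
next
  fix u v assume uv: "u \<in> rowwise_multiples smul y" "v \<in> rowwise_multiples smul y"
  have "\<exists>c. \<forall>j. (u + v) (prod_encode (i, j)) = smul c (y j)" for i
  proof -
    obtain a b where "\<forall>j. u (prod_encode (i, j)) = smul a (y j)"
      "\<forall>j. v (prod_encode (i, j)) = smul b (y j)"
      using uv unfolding rowwise_multiples_def by blast
    then show ?thesis by (intro exI[of _ "a + b"]) (simp add: X.scale_left_distrib)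
  qed
  then show "u + v \<in> rowwise_multiples smul y" by (simp add: rowwise_multiples_def)
next
  fix c u assume u: "u \<in> rowwise_multiples smul y"
  have "\<exists>d. \<forall>j. seq_scale smul c u (prod_encode (i, j)) = smul d (y j)" for i
  proof -
    obtain a where "\<forall>j. u (prod_encode (i, j)) = smul a (y j)"
      using u unfolding rowwise_multiples_def by blast
    then show ?thesis by (intro exI[of _ "c * a"]) (simp add: seq_scale_def)
  qed
  then show "seq_scale smul c u \<in> rowwise_multiples smul y" by (simp add: rowwise_multiples_def)
qed

text \<open>A point that \<open>E\<close>-balls cannot separate from the rowwise multiples has, as the quasi-norm
  dominates every coordinate, rows that are uniformly approximable by multiples of \<open>y\<close>.\<close>

lemma closedin_rowwise_multiples:
  assumes y: "y k \<noteq> 0"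
  shows "closedin (quasi_norm_topology E N) (E \<inter> rowwise_multiples smul y)"
    (is "closedin _ ?V")
proof -
  have "\<exists>e>0. \<forall>v\<in>E. N (v - x) < e \<longrightarrow> v \<in> E - ?V" if x: "x \<in> E - ?V" for x
  proof (rule ccontr)
    assume "\<not> ?thesis"
    then have near: "\<exists>v\<in>?V. N (v - x) < e" if "e > 0" for e
      using that by blast
    have "\<exists>c. \<forall>j. x (prod_encode (i, j)) = smul c (y j)" for i
    proof (rule X.scalar_multiple_if_approximable)
      show "y k \<noteq> 0" by fact
      fix e :: real assume "e > 0"
      then obtain v where v: "v \<in> ?V" "N (v - x) < e" using near by blast
      then obtain c where c: "\<And>j. v (prod_encode (i, j)) = smul c (y j)"
        unfolding rowwise_multiples_def by blast
      have "v - x \<in> E" using v x subspace_diff[OF subspace_E] by blast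
      then have "norm ((v - x) n) < e" for n using norm_le_N[of "v - x" n] v(2) by linarith
      then have "norm (smul c (y j) - x (prod_encode (i, j))) < e" for j
        by (metis c fun_diff_def)
      then show "\<exists>c. \<forall>j. norm (smul c (y j) - x (prod_encode (i, j))) < e" by blast
    qed
    then have "x \<in> rowwise_multiples smul y" by (simp add: rowwise_multiples_def)
    then show False using x by blast
  qed
  then show ?thesis
    by (auto simp: closedin_def openin_quasi_norm_topology)
qed

text \<open>The other one-row sequences all vanish on row \<open>i\<close>, and so does their span.\<close>

lemma independent_one_rows:
  assumes y: "y k \<noteq> 0"
  shows "independent (range (one_row y))"
proof
  assume "dependent (range (one_row y))"
  then obtain i where i: "one_row y i \<in> span (range (one_row y) - {one_row y i})"
    unfolding dependent_def by blast
  let ?Z = "{z. z (prod_encode (i, k)) = (0::'a)}"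
  have "range (one_row y) - {one_row y i} \<subseteq> ?Z" by auto
  moreover have "subspace ?Z"
    by (rule subspaceI) (auto simp: seq_scale_def)
  ultimately have "span (range (one_row y) - {one_row y i}) \<subseteq> ?Z" by (rule span_minimal)
  then show False using i y by auto
qed

lemma infinite_dimensional_rowwise_multiples:
  assumes y: "y \<in> E" "\<And>j. y j \<noteq> 0"
  shows "infinite_dimensional (E \<inter> rowwise_multiples smul y)"
  unfolding infinite_dimensional_def
proof
  assume "\<exists>B. finite B \<and> B \<subseteq> E \<inter> rowwise_multiples smul y \<and>
    E \<inter> rowwise_multiples smul y \<subseteq> span B"
  then obtain B where B: "finite B" "E \<inter> rowwise_multiples smul y \<subseteq> span B" by blast
  have "one_row y i \<in> E" for i
  proof -
    have "zerofree (one_row y i) = y" by (rule zerofree_one_row) (rule y)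
    moreover have "y \<noteq> 0" using y(2)[of 0] by auto
    ultimately show ?thesis using mem_iff_zerofree_mem[of "one_row y i"] y(1) by simp
  qed
  moreover have "one_row y i \<in> rowwise_multiples smul y" for i
  proof -
    have "\<exists>c. \<forall>j. one_row y i (prod_encode (k, j)) = smul c (y j)" for k
      by (rule exI[of _ "if k = i then 1 else 0"]) simp
    then show ?thesis by (simp add: rowwise_multiples_def)
  qed
  ultimately have "range (one_row y) \<subseteq> span B" using B(2) by blast
  then have "finite (range (one_row y))"
    using independent_span_bound[OF B(1) independent_one_rows[of y 0]] y(2) by blast
  moreover have "inj (one_row y)"
  proof (rule injI)
    fix i k assume "one_row y i = one_row y k"
    then have "one_row y i (prod_encode (i, 0)) = one_row y k (prod_encode (i, 0))" by simp
    then show "i = k" using y(2) by (auto split: if_splits)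
  qed
  ultimately show False by (simp add: finite_image_iff)
qed

text \<open>A row of a sequence is a subsequence of it, so membership in \<open>A\<close> descends from \<open>z\<close> to its
  non-zero row \<open>c y\<close>, and scaling by \<open>c\<^sup>-\<^sup>1\<close> brings it to \<open>y\<close>.\<close>

lemma rowwise_multiples_avoid:
  assumes A: "zero_insensitive smul A" and y: "y \<notin> A"
  shows "rowwise_multiples smul y \<subseteq> - A \<union> {0}"
proof
  fix z assume z: "z \<in> rowwise_multiples smul y"
  show "z \<in> - A \<union> {0}"
  proof (rule ccontr)
    assume "z \<notin> - A \<union> {0}"
    then have zA: "z \<in> A" and "z \<noteq> 0" by auto
    then obtain n where "z n \<noteq> 0" by (auto simp: fun_eq_iff)
    then obtain i k where ik: "z (prod_encode (i, k)) \<noteq> 0"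
      by (metis prod_decode_inverse surj_pair)
    obtain c where c: "\<And>j. z (prod_encode (i, j)) = smul c (y j)"
      using z unfolding rowwise_multiples_def by blast
    have "c \<noteq> 0" using ik c by auto
    have "z \<circ> (\<lambda>j. prod_encode (i, j)) \<in> A"
      by (rule zero_insensitiveD(2)[OF A zA strict_mono_prod_encode])
    then have "seq_scale smul (inverse c) (z \<circ> (\<lambda>j. prod_encode (i, j))) \<in> A"
      by (rule zero_insensitiveD(4)[OF A])
    also have "seq_scale smul (inverse c) (z \<circ> (\<lambda>j. prod_encode (i, j))) = y"
      using \<open>c \<noteq> 0\<close> by (simp add: seq_scale_def c fun_eq_iff)
    finally show False using y by blast
  qed
qed

section \<open>Spaceability\<close>

lemma obtain_zerofree_outside:
  assumes A: "zero_insensitive smul A" and x: "x \<in> E - A"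
  obtains y where "y \<in> E - A" and "\<And>j. y j \<noteq> 0"
proof -
  let ?S = "{i. x i \<noteq> 0}"
  have S: "infinite ?S" using zero_insensitiveD(1)[OF A, of x] x by blast
  have g: "strict_mono (enumerate ?S)" "range (enumerate ?S) = ?S"
    by (rule strict_mono_enumerate[OF S], rule range_enumerate[OF S])
  have eq: "zerofree x = x \<circ> enumerate ?S" by (rule zerofree_eq_comp[OF g(1) g(2)[symmetric]])
  have nz: "zerofree x j \<noteq> 0" for j
    using enumerate_in_set[OF S, of j] by (simp add: eq)
  then have "zerofree x \<noteq> 0" by auto
  then have "zerofree x \<in> E" using mem_iff_zerofree_mem x by blast
  moreover have "zerofree x \<notin> A"
  proof
    assume "zerofree x \<in> A"
    then have "x \<circ> enumerate ?S \<in> A" by (simp only: eq)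
    moreover have "\<forall>n. n \<notin> range (enumerate ?S) \<longrightarrow> x n = 0" unfolding g(2) by simp
    ultimately have "x \<in> A" by (rule zero_insensitiveD(3)[OF A g(1), rotated])
    then show False using x by blast
  qed
  ultimately show thesis using that nz by blast
qed

lemma empty_or_spaceable_Diff:
  assumes A: "zero_insensitive smul A"
  shows "E - A = {} \<or> spaceable (E - A)"
proof (cases "E - A = {}")
  case False
  then obtain x where "x \<in> E - A" by blast
  then obtain y where y: "y \<in> E - A" "\<And>j. y j \<noteq> 0" using obtain_zerofree_outside[OF A] by blast
  have "E \<inter> rowwise_multiples smul y \<subseteq> (E - A) \<union> {0}"
    using rowwise_multiples_avoid[OF A, of y] y(1) by blast
  moreover have "subspace (E \<inter> rowwise_multiples smul y)"
    by (intro subspace_inter subspace_E subspace_rowwise_multiples)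
  ultimately show ?thesis
    unfolding spaceable_def
    using infinite_dimensional_rowwise_multiples[of y] closedin_rowwise_multiples[of y 0] y by blast
qed simp

lemma spaceable_whole_space: "spaceable E"
  unfolding spaceable_def
  using subspace_E infinite_dimensional_E closedin_topspace[of "quasi_norm_topology E N"]
  by (intro exI[of _ E]) auto

end

theorem theorem1p3:
  fixes smul :: "'k::real_or_complex \<Rightarrow> 'a::banach \<Rightarrow> 'a"
    and E :: "(nat \<Rightarrow> 'a) set" and N :: "(nat \<Rightarrow> 'a) \<Rightarrow> real"
  assumes X_nonzero: "\<exists>x::'a. x \<noteq> 0"
    and E: "invariant_sequence_space smul E N"
  shows "(\<forall>\<Gamma>::ereal set. \<Gamma> \<subseteq> {0<..} \<longrightarrow>
            E - (\<Union>q\<in>\<Gamma>. ell q) = {} \<or>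
            quasi_banach_space.spaceable (seq_scale smul) E N (E - (\<Union>q\<in>\<Gamma>. ell q))) \<and>
         (E - c_zero = {} \<or>
            quasi_banach_space.spaceable (seq_scale smul) E N (E - c_zero))"
proof (intro conjI allI impI)
  interpret invariant_sequence_space smul E N by (rule E)
  show "E - c_zero = {} \<or> spaceable (E - c_zero)"
    by (intro empty_or_spaceable_Diff zero_insensitive_c_zero X.banach_space_over_axioms)
  fix \<Gamma> :: "ereal set" assume "\<Gamma> \<subseteq> {0<..}"
  show "E - (\<Union>q\<in>\<Gamma>. ell q) = {} \<or> spaceable (E - (\<Union>q\<in>\<Gamma>. ell q))"
  proof (cases "\<Gamma> = {}")
    \<comment> \<open>The empty union does not contain the finitely supported sequences.\<close>
    case True
    then show ?thesis using spaceable_whole_space by simp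
  next
    case False
    then have "zero_insensitive smul (\<Union>q\<in>\<Gamma>. ell q)"
      by (intro zero_insensitive_Union)
        (auto intro!: zero_insensitive_ell X.banach_space_over_axioms)
    then show ?thesis by (rule empty_or_spaceable_Diff)
  qed
qed

end
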